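(* Let $l,m\in\mathbb{N}^*$, $V_t=\mathbb{R}^l$, $V_x=\mathbb{R}^m$ and $V=\mathbb{R}^{l\times m}$. Suppose that $\mathcal{E}:V\to\mathbb{R}$ satisfies assumptions $(A3)$ and $(A4)$ (stated in the context), and let $(u_n)_{n\in\mathbb{N}^*}$ be a sequence generated by the local-minimum greedy algorithm (described in the context). Then there exist two constants $\tau>0$ and $\sigma\in(0,1)$ such that for all $n\in\mathbb{N}^*$, $$0\le \mathcal{E}(u_n)-\mathcal{E}(u)\le \tau\sigma^n$$ and $$\|u-u_n\|_V\le\sqrt{\frac{2\tau}{\alpha}}\,\sigma^{n/2}.$$
   Context: $\mathbb{N}^*=\{1,2,\dots\}$. $V_t=\mathbb{R}^l$, $V_x=\mathbb{R}^m$, $V=\mathbb{R}^{l\times m}$ are endowed with Hilbert space structures; the scalar product and norm of $V$ are denoted $\langle\cdot,\cdot\rangle$ and $\|\cdot\|_V$. The tensor product of $R\in\mathbb{R}^l$ and $S\in\mathbb{R}^m$ is the rank-at-most-one matrix $R\otimes S=RS^T\in\mathbb{R}^{l\times m}$. $\mathcal{E}:V\to\mathbb{R}$ is differentiable with gradient $\mathcal{E}'(v)\in V$ at $v$. Assumptions on $\mathcal{E}$: - $(A3)$ $\mathcal{E}$ is strongly convex: there is $\alpha>0$ such that for all $v,w\in V$, $\mathcal{E}(v)\ge \mathcal{E}(w)+\langle \mathcal{E}'(w),v-w\rangle+\frac{\alpha}{2}\|v-w\|_V^2$. The constant $\alpha$ in the claim is this one. - $(A4)$ The gradient of $\mathcal{E}$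 is Lipschitz on bounded sets: for each bounded $K\subset V$ there is $L_K\ge 0$ such that $\|\mathcal{E}'(v)-\mathcal{E}'(w)\|_V\le L_K\|v-w\|_V$ for all $v,w\in K$. $u$ denotes the unique global minimizer of $\mathcal{E}$ on $V$. Local-minimum greedy algorithm: set $u_0=0$. For $n\in\mathbb{N}^*$, choose $(r_n,s_n)\in V_t\times V_x$ to be a local minimizer of $(r,s)\mapsto\mathcal{E}(u_{n-1}+r\otimes s)$ on $V_t\times V_x$ such that $u_n=u_{n-1}+r_n\otimes s_n$ satisfies $\mathcal{E}(u_n)<\mathcal{E}(u_{n-1})$. If $u_{n-1}=u$ the algorithm stops, and by convention $u_k=u$ for all $k\ge n-1$. *)

theory Defs
  imports "HOL-Analysis.Analysis"
begin

text \<open>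
  The Hilbert space structure on \<open>V = \<real>\<^sup>l\<^sup>\<times>\<^sup>m\<close> is an arbitrary inner product \<open>B\<close>, not
  necessarily the one of the type class instance (the Frobenius product). Since \<open>V\<close>
  is finite-dimensional, differentiability, boundedness and local minimality do not
  depend on the chosen norms, so the library notions are used for these; only the
  gradient and the metric estimates refer to \<open>B\<close>. For the same reason the inner
  products of the two factor spaces do not occur.
\<close>

definition inner_product :: "('v::real_vector \<Rightarrow> 'v \<Rightarrow> real) \<Rightarrow> bool" where
  "inner_product B \<longleftrightarrow>
     bilinear B \<and> (\<forall>v w. B v w = B w v) \<and> (\<forall>v. v \<noteq> 0 \<longrightarrow> B v v > 0)"

definition norm_of :: "('v \<Rightarrow> 'v \<Rightarrow> real) \<Rightarrow> 'v \<Rightarrow> real" where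
  "norm_of B v = sqrt (B v v)"

definition is_gradient ::
  "('v::real_normed_vector \<Rightarrow> 'v \<Rightarrow> real) \<Rightarrow> ('v \<Rightarrow> real) \<Rightarrow> ('v \<Rightarrow> 'v) \<Rightarrow> bool" where
  "is_gradient B E E' \<longleftrightarrow> (\<forall>v. (E has_derivative (\<lambda>h. B (E' v) h)) (at v))"

definition strongly_convex ::
  "('v::real_vector \<Rightarrow> 'v \<Rightarrow> real) \<Rightarrow> real \<Rightarrow> ('v \<Rightarrow> real) \<Rightarrow> ('v \<Rightarrow> 'v) \<Rightarrow> bool" where
  "strongly_convex B \<alpha> E E' \<longleftrightarrow>
     \<alpha> > 0 \<and>
     (\<forall>v w. E v \<ge> E w + B (E' w) (v - w) + \<alpha> / 2 * (norm_of B (v - w))\<^sup>2)"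

definition lipschitz_on_bounded ::
  "('v::real_normed_vector \<Rightarrow> 'v \<Rightarrow> real) \<Rightarrow> ('v \<Rightarrow> 'v) \<Rightarrow> bool" where
  "lipschitz_on_bounded B E' \<longleftrightarrow>
     (\<forall>K. bounded K \<longrightarrow>
        (\<exists>L\<ge>0. \<forall>v\<in>K. \<forall>w\<in>K. norm_of B (E' v - E' w) \<le> L * norm_of B (v - w)))"

definition tensor :: "real ^ 'l \<Rightarrow> real ^ 'm \<Rightarrow> real ^ 'm ^ 'l"  (infixl \<open>\<otimes>\<^sub>t\<close> 75) where
  "r \<otimes>\<^sub>t s = (\<chi> i j. r $ i * s $ j)"

definition is_local_minimizer :: "('a::topological_space \<Rightarrow> real) \<Rightarrow> 'a \<Rightarrow> bool" where
  "is_local_minimizer f x \<longleftrightarrow> (\<forall>\<^sub>F y in nhds x. f x \<le> f y)"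

text \<open>
  Meaningful only if \<open>E\<close> has exactly one global minimizer, as is the case for
  a differentiable strongly convex function.
\<close>

definition global_minimizer :: "('v \<Rightarrow> real) \<Rightarrow> 'v" where
  "global_minimizer E = (THE u. \<forall>v. E u \<le> E v)"

text \<open>
  The first case of the recursion is the stopping convention: once the minimizer is
  reached, the sequence stays there.
\<close>

definition local_greedy_sequence ::
  "(real ^ 'm ^ 'l \<Rightarrow> real) \<Rightarrow> (nat \<Rightarrow> real ^ 'm ^ 'l) \<Rightarrow> bool" where
  "local_greedy_sequence E u \<longleftrightarrow>
     u 0 = 0 \<and>
     (\<forall>n\<ge>1.
        if u (n - 1) = global_minimizer E then u n = global_minimizer E
        else \<exists>r s. is_local_minimizer (\<lambda>(r', s'). E (u (n - 1) + r' \<otimes>\<^sub>t s')) (r, s) \<and>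
                   u n = u (n - 1) + r \<otimes>\<^sub>t s \<and>
                   E (u n) < E (u (n - 1)))"

end

theory Submission
  imports Defs
begin

text \<open>
  Write \<open>x\<^sub>n = r\<^sub>n \<otimes>\<^sub>t s\<^sub>n\<close> for the increment of step \<open>n\<close>, \<open>g\<^sub>n = E' u\<^sub>n\<close> for the gradient
  after it, \<open>a\<^sub>n = E u\<^sub>n - min E\<close> for the energy excess, and \<open>\<parallel>\<cdot>\<parallel>\<close> for the norm of \<open>B\<close>. Linear
  convergence follows from three inequalities, with constants independent of \<open>n\<close>:

  \<^item> The excess is controlled by the gradient, \<open>a\<^sub>n \<le> \<parallel>g\<^sub>n\<parallel>\<^sup>2 / (2 * \<alpha>)\<close>; this is strong convexity
    alone (\<open>excess_le_gradient\<close>).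

  \<^item> The decrease of a step is controlled from below by its increment,
    \<open>a\<^sub>n\<^sub>-\<^sub>1 - a\<^sub>n \<ge> \<alpha> / 2 * \<parallel>x\<^sub>n\<parallel>\<^sup>2\<close>; this is strong convexity together with the Euler equation
    \<open>B g\<^sub>n x\<^sub>n = 0\<close>, which holds since scaling \<open>r\<^sub>n\<close> must not lower the energy
    (\<open>local_minimizer_orthogonal\<close>).

  \<^item> The gradient is controlled by the increment, \<open>\<parallel>g\<^sub>n\<parallel> \<le> G * \<parallel>x\<^sub>n\<parallel>\<close>. This is where local
    minimality in \<open>r\<close> and \<open>s\<close> jointly is exploited to second order. Moving \<open>(r\<^sub>n, s\<^sub>n)\<close> in the
    direction \<open>(\<rho>, \<eta>)\<close> changes the tensor by \<open>\<epsilon> p + \<epsilon>\<^sup>2 z\<close> with \<open>p = r\<^sub>n \<otimes>\<^sub>t \<eta> + \<rho> \<otimes>\<^sub>t s\<^sub>n\<close>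
    and \<open>z = \<rho> \<otimes>\<^sub>t \<eta>\<close>. The first-order terms cancel between \<open>\<epsilon>\<close> and \<open>-\<epsilon>\<close>, and the
    \<open>\<epsilon>\<^sup>2\<close> terms give \<open>- B g\<^sub>n z \<le> L * \<parallel>p\<parallel>\<^sup>2\<close> (\<open>local_minimizer_second_order\<close>). The
    direction \<open>(t \<rho>, \<eta> / t)\<close> has the same \<open>z\<close>; the \<open>t\<close> that balances the two summands of \<open>p\<close> turns the
    right-hand side into a multiple of \<open>\<parallel>x\<^sub>n\<parallel> * \<parallel>z\<parallel>\<close> (\<open>local_minimizer_rank_one_bound\<close>). So \<open>g\<^sub>n\<close> is
    \<open>O(\<parallel>x\<^sub>n\<parallel>)\<close> against tensors of rank one, and these span the space
    (\<open>local_minimizer_gradient_bound\<close>).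

  Together, \<open>a\<^sub>n \<le> D * (a\<^sub>n\<^sub>-\<^sub>1 - a\<^sub>n)\<close> for some \<open>D > 0\<close>, so \<open>a\<^sub>n \<le> D / (1 + D) * a\<^sub>n\<^sub>-\<^sub>1\<close>. The Lipschitz constant
  \<open>L\<close> can be chosen once for all steps because the energies never increase, so that all iterates
  lie in the sublevel set \<open>{v. E v \<le> E 0}\<close>, which is bounded by strong convexity.
\<close>

section \<open>Inner products on a Euclidean space\<close>

lemma inner_product_self_nonneg:
  assumes "inner_product B"
  shows "B v v \<ge> 0"
  using assms unfolding inner_product_def
  by (cases "v = 0") (auto simp: bilinear_lzero less_imp_le)

lemma norm_of_square: "inner_product B \<Longrightarrow> (norm_of B v)\<^sup>2 = B v v"
  by (simp add: norm_of_def inner_product_self_nonneg)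

lemma norm_of_nonneg: "inner_product B \<Longrightarrow> norm_of B v \<ge> 0"
  by (simp add: norm_of_def inner_product_self_nonneg)

lemma norm_of_scaleR:
  assumes "inner_product B"
  shows "norm_of B (t *\<^sub>R v) = \<bar>t\<bar> * norm_of B v"
proof -
  have bil: "bilinear B" using assms by (simp add: inner_product_def)
  show ?thesis
    by (simp add: norm_of_def bilinear_lmul[OF bil] bilinear_rmul[OF bil]
        real_sqrt_mult flip: mult.assoc)
qed

lemma norm_of_minus: "inner_product B \<Longrightarrow> norm_of B (- v) = norm_of B v"
  using norm_of_scaleR[of B "-1" v] by simp

lemma norm_of_square_add_scaleR:
  assumes "inner_product B"
  shows "(norm_of B (v + t *\<^sub>R w))\<^sup>2
    = (norm_of B v)\<^sup>2 + 2 * t * B v w + t\<^sup>2 * (norm_of B w)\<^sup>2"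
proof -
  have bil: "bilinear B" and sym: "B w v = B v w"
    using assms by (auto simp: inner_product_def)
  show ?thesis
    unfolding norm_of_square[OF assms]
    by (simp add: bilinear_ladd[OF bil] bilinear_radd[OF bil] bilinear_lmul[OF bil]
        bilinear_rmul[OF bil] sym power2_eq_square algebra_simps)
qed

text \<open>
  This form of the Cauchy--Schwarz inequality is the nonnegativity of \<open>\<parallel>x - L y\<parallel>\<^sup>2\<close>.
\<close>

lemma inner_product_le_of_norm_le:
  assumes "inner_product B" and "L > 0" and "norm_of B x \<le> L * norm_of B y"
  shows "B x y \<le> L * (norm_of B y)\<^sup>2"
proof -
  have "0 \<le> (norm_of B (x + (- L) *\<^sub>R y))\<^sup>2" by simp
  also have "\<dots> = (norm_of B x)\<^sup>2 - 2 * L * B x y + L\<^sup>2 * (norm_of B y)\<^sup>2"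
    unfolding norm_of_square_add_scaleR[OF assms(1)] by simp
  also have "(norm_of B x)\<^sup>2 \<le> L\<^sup>2 * (norm_of B y)\<^sup>2"
    using power_mono[OF assms(3) norm_of_nonneg[OF assms(1)], of 2]
    by (simp add: power_mult_distrib)
  finally have "L * B x y \<le> L * (L * (norm_of B y)\<^sup>2)"
    by (simp add: power2_eq_square)
  then show ?thesis using \<open>L > 0\<close> by simp
qed

lemma norm_of_le_norm:
  fixes B :: "'v::euclidean_space \<Rightarrow> 'v \<Rightarrow> real"
  assumes "inner_product B"
  obtains C where "C > 0" and "\<And>v. norm_of B v \<le> C * norm v"
proof -
  have "bilinear B" using assms by (simp add: inner_product_def)
  then obtain M where M: "M > 0" "\<And>x y. norm (B x y) \<le> M * norm x * norm y"
    using bilinear_bounded_pos by blast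
  have "norm_of B v \<le> sqrt M * norm v" for v
  proof -
    have "norm_of B v \<le> sqrt (M * (norm v)\<^sup>2)"
      unfolding norm_of_def using M(2)[of v v] by (simp add: power2_eq_square mult.assoc)
    then show ?thesis by (simp add: real_sqrt_mult)
  qed
  then show ?thesis using that[of "sqrt M"] M(1) by simp
qed

text \<open>
  By homogeneity it suffices to bound \<open>norm_of B\<close> from below on the unit sphere, where a
  minimum is attained by compactness.
\<close>

lemma norm_le_norm_of:
  fixes B :: "'v::euclidean_space \<Rightarrow> 'v \<Rightarrow> real"
  assumes "inner_product B"
  obtains c where "c > 0" and "\<And>v. c * norm v \<le> norm_of B v"
proof -
  have bil: "bilinear B" and pos: "\<And>v. v \<noteq> 0 \<Longrightarrow> B v v > 0"
    using assms by (auto simp: inner_product_def)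
  let ?S = "sphere (0::'v) 1"
  have "continuous_on ?S (\<lambda>v. B v v)"
    using bil bilinear_continuous_on_compose continuous_on_id by blast
  then have "continuous_on ?S (norm_of B)"
    unfolding norm_of_def by (intro continuous_on_real_sqrt)
  moreover have "?S \<noteq> {}" using vector_choose_size[of 1] by force
  ultimately obtain w where w: "w \<in> ?S" "\<And>v. v \<in> ?S \<Longrightarrow> norm_of B w \<le> norm_of B v"
    using continuous_attains_inf[of ?S "norm_of B"] by auto
  have "norm_of B w * norm v \<le> norm_of B v" for v
  proof (cases "v = 0")
    case True
    then show ?thesis by (simp add: norm_of_nonneg[OF assms])
  next
    case False
    let ?v = "inverse (norm v) *\<^sub>R v"
    have "norm_of B w \<le> norm_of B ?v" by (rule w(2)) (use False in simp)
    also have "norm_of B ?v = inverse (norm v) * norm_of B v"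
      by (simp add: norm_of_scaleR[OF assms])
    finally show ?thesis using False by (simp add: field_simps)
  qed
  moreover have "norm_of B w > 0"
    unfolding norm_of_def using pos[of w] w(1) by force
  ultimately show ?thesis using that by blast
qed

section \<open>Strongly convex energies\<close>

locale strongly_convex_energy =
  fixes B :: "'v::euclidean_space \<Rightarrow> 'v \<Rightarrow> real"
    and E :: "'v \<Rightarrow> real" and E' :: "'v \<Rightarrow> 'v" and \<alpha> :: real
  assumes inner_product: "inner_product B"
    and gradient: "is_gradient B E E'"
    and convex: "strongly_convex B \<alpha> E E'"
begin

lemma alpha_pos: "\<alpha> > 0"
  using convex by (simp add: strongly_convex_def)

lemma bilinear: "bilinear B"
  using inner_product by (simp add: inner_product_def)

lemma strong_convexity:
  "E v \<ge> E w + B (E' w) (v - w) + \<alpha> / 2 * (norm_of B (v - w))\<^sup>2"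
  using convex by (simp add: strongly_convex_def)

lemma has_derivative: "(E has_derivative B (E' v)) (at v)"
  using gradient unfolding is_gradient_def by simp

text \<open>
  Where \<open>E v \<le> E 0\<close>, strong convexity around \<open>0\<close> forces its quadratic term in \<open>v\<close> to be at most
  the absolute value of its linear term.
\<close>

lemma bounded_sublevel:
  obtains R where "R > 0" and "\<And>v. E v \<le> E 0 \<Longrightarrow> norm v \<le> R"
proof -
  obtain M where M: "M > 0" "\<And>x y. norm (B x y) \<le> M * norm x * norm y"
    using bilinear_bounded_pos[OF bilinear] by blast
  obtain c where c: "c > 0" "\<And>v. c * norm v \<le> norm_of B v"
    using norm_le_norm_of[OF inner_product] by blast
  define b where "b = \<alpha> / 2 * c\<^sup>2"
  have "b > 0" using alpha_pos c(1) by (simp add: b_def)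
  define R where "R = M * norm (E' 0) / b + 1"
  have "norm v \<le> R" if "E v \<le> E 0" for v
  proof -
    have "b * (norm v)\<^sup>2 \<le> \<alpha> / 2 * (norm_of B v)\<^sup>2"
      using power_mono[OF c(2)[of v], of 2] c(1) alpha_pos
      by (simp add: b_def power_mult_distrib)
    also have "\<dots> \<le> - B (E' 0) v" using strong_convexity[of 0 v] that by simp
    also have "\<dots> \<le> M * norm (E' 0) * norm v" using M(2)[of "E' 0" v] by simp
    finally have "(b * norm v) * norm v \<le> (M * norm (E' 0)) * norm v"
      by (simp add: power2_eq_square mult.assoc)
    then have "v = 0 \<or> b * norm v \<le> M * norm (E' 0)"
      by (metis mult_right_le_imp_le zero_less_norm_iff)
    then have "norm v \<le> M * norm (E' 0) / b"
      using \<open>b > 0\<close> M(1) by (auto simp: field_simps)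
    then show ?thesis by (simp add: R_def)
  qed
  moreover have "R > 0" using \<open>b > 0\<close> M(1) by (simp add: R_def add_nonneg_pos)
  ultimately show ?thesis using that by blast
qed

lemma gradient_zero_of_minimizer:
  assumes "\<And>v. E w \<le> E v"
  shows "B (E' w) h = 0"
proof -
  have "B (E' w) = (\<lambda>h. 0)"
    by (rule differential_zero_maxmin[OF UNIV_I open_UNIV has_derivative]) (simp add: assms)
  then show ?thesis by simp
qed

lemma ex1_minimizer: "\<exists>!w. \<forall>v. E w \<le> E v"
proof -
  obtain R where R: "R > 0" "\<And>v. E v \<le> E 0 \<Longrightarrow> norm v \<le> R"
    using bounded_sublevel by blast
  have "continuous_on (cball 0 R) E"
    by (intro continuous_at_imp_continuous_on ballI has_derivative_continuous[OF has_derivative])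
  then obtain w where w: "\<And>v. v \<in> cball 0 R \<Longrightarrow> E w \<le> E v"
    using continuous_attains_inf[of "cball 0 R" E] R(1) by fastforce
  have min: "E w \<le> E v" for v
  proof (cases "norm v \<le> R")
    case True
    then show ?thesis by (intro w) simp
  next
    case False
    then show ?thesis using R(2)[of v] w[of 0] R(1) by force
  qed
  have "x = w" if "\<forall>v. E x \<le> E v" for x
  proof (rule ccontr)
    assume "x \<noteq> w"
    then have "B (x - w) (x - w) > 0" using inner_product by (simp add: inner_product_def)
    then have "0 < \<alpha> / 2 * (norm_of B (x - w))\<^sup>2"
      using alpha_pos by (simp add: norm_of_square[OF inner_product])
    moreover have "E x \<le> E w" using that by blast
    ultimately show False
      using strong_convexity[of w x] gradient_zero_of_minimizer[OF min, of "x - w"] by linarith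
  qed
  with min show ?thesis by blast
qed

lemma global_minimizer_le: "E (global_minimizer E) \<le> E v"
  using theI'[OF ex1_minimizer] unfolding global_minimizer_def by blast

lemma distance_le_excess:
  "\<alpha> / 2 * (norm_of B (global_minimizer E - v))\<^sup>2 \<le> E v - E (global_minimizer E)"
proof -
  let ?w = "global_minimizer E"
  have "norm_of B (?w - v) = norm_of B (v - ?w)"
    using norm_of_minus[OF inner_product, of "v - ?w"] by simp
  then show ?thesis
    using strong_convexity[of ?w v] gradient_zero_of_minimizer[OF global_minimizer_le, of "v - ?w"]
    by simp
qed

text \<open>
  The right-hand side is the gap between \<open>E v\<close> and the minimum of the quadratic lower bound
  that strong convexity provides around \<open>v\<close>.
\<close>

lemma excess_le_gradient:
  "E v - E w \<le> (norm_of B (E' v))\<^sup>2 / (2 * \<alpha>)"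
proof -
  let ?h = "w - v"
  have "0 \<le> (norm_of B (E' v + \<alpha> *\<^sub>R ?h))\<^sup>2" by simp
  also have "\<dots> = (norm_of B (E' v))\<^sup>2 + 2 * \<alpha> * B (E' v) ?h + \<alpha>\<^sup>2 * (norm_of B ?h)\<^sup>2"
    by (rule norm_of_square_add_scaleR[OF inner_product])
  also have "\<dots> = (norm_of B (E' v))\<^sup>2
      + 2 * \<alpha> * (B (E' v) ?h + \<alpha> / 2 * (norm_of B ?h)\<^sup>2)"
    by (simp add: power2_eq_square algebra_simps)
  also have "\<dots> \<le> (norm_of B (E' v))\<^sup>2 + 2 * \<alpha> * (E w - E v)"
    using strong_convexity[of v w] alpha_pos by simp
  finally show ?thesis using alpha_pos by (simp add: field_simps)
qed

text \<open>
  Convexity at the end point \<open>v\<close> bounds the increment of \<open>E\<close> by \<open>B (E' v) (v - w)\<close>, so no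
  integration of the gradient along the segment is required; the price is the constant \<open>L\<close>
  instead of \<open>L / 2\<close>.
\<close>

lemma quadratic_upper_bound:
  assumes "L > 0" and "norm_of B (E' v - E' w) \<le> L * norm_of B (v - w)"
  shows "E v \<le> E w + B (E' w) (v - w) + L * (norm_of B (v - w))\<^sup>2"
proof -
  have "B (E' v) (w - v) = - B (E' v) (v - w)"
    using bilinear_rneg[OF bilinear, of "E' v" "v - w"] by simp
  then have "E v \<le> E w + B (E' v) (v - w)"
    using strong_convexity[of v w] alpha_pos
    by (smt (verit) divide_nonneg_nonneg mult_nonneg_nonneg zero_le_power2)
  also have "B (E' v) (v - w) = B (E' w) (v - w) + B (E' v - E' w) (v - w)"
    by (simp add: bilinear_lsub[OF bilinear])
  also have "B (E' v - E' w) (v - w) \<le> L * (norm_of B (v - w))\<^sup>2"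
    by (rule inner_product_le_of_norm_le[OF inner_product assms])
  finally show ?thesis by simp
qed

text \<open>
  The bound holds around every point of the sublevel set of \<open>0\<close> with the same \<open>L\<close>: the gradient
  is Lipschitz on the bounded set of all points at distance at most \<open>1\<close> from it.
\<close>

lemma uniform_quadratic_upper_bound:
  assumes "lipschitz_on_bounded B E'"
  obtains L where "L > 0"
    and "\<And>v h. E v \<le> E 0 \<Longrightarrow> norm h \<le> 1 \<Longrightarrow>
           E (v + h) \<le> E v + B (E' v) h + L * (norm_of B h)\<^sup>2"
proof -
  obtain R where R: "R > 0" "\<And>v. E v \<le> E 0 \<Longrightarrow> norm v \<le> R"
    using bounded_sublevel by blast
  obtain L where L: "L \<ge> 0" "\<And>v w. v \<in> cball 0 (R + 1) \<Longrightarrow> w \<in> cball 0 (R + 1) \<Longrightarrow>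
      norm_of B (E' v - E' w) \<le> L * norm_of B (v - w)"
    using assms[unfolded lipschitz_on_bounded_def, rule_format, OF bounded_cball[of 0 "R + 1"]]
    by auto
  have "E (v + h) \<le> E v + B (E' v) h + (L + 1) * (norm_of B h)\<^sup>2"
    if "E v \<le> E 0" "norm h \<le> 1" for v h
  proof -
    have "norm (v + h) \<le> R + 1" "norm v \<le> R + 1"
      using R(2)[OF that(1)] that(2) norm_triangle_ineq[of v h] by linarith+
    then have "norm_of B (E' (v + h) - E' v) \<le> L * norm_of B (v + h - v)"
      by (intro L(2)) simp_all
    also have "\<dots> \<le> (L + 1) * norm_of B (v + h - v)"
      by (intro mult_right_mono norm_of_nonneg[OF inner_product]) simp
    finally show ?thesis
      using quadratic_upper_bound[of "L + 1" "v + h" v] L(1) by simp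
  qed
  then show ?thesis using that[of "L + 1"] L(1) by simp
qed

end

section \<open>Tensors of rank one\<close>

lemma bilinear_tensor: "bilinear (\<otimes>\<^sub>t)"
  unfolding bilinear_def tensor_def
  by (auto intro!: linearI simp: vec_eq_iff algebra_simps)

lemmas tensor_simps =
  bilinear_ladd[OF bilinear_tensor] bilinear_radd[OF bilinear_tensor]
  bilinear_lmul[OF bilinear_tensor] bilinear_rmul[OF bilinear_tensor]
  bilinear_lzero[OF bilinear_tensor] bilinear_rzero[OF bilinear_tensor]

lemma norm_tensor: "norm (r \<otimes>\<^sub>t s) = norm r * norm s"
proof -
  have row: "(r \<otimes>\<^sub>t s) $ i = (r $ i) *\<^sub>R s" for i
    by (simp add: tensor_def vec_eq_iff)
  have "norm (r \<otimes>\<^sub>t s) = L2_set (\<lambda>i. norm s * norm (r $ i)) UNIV"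
    by (simp add: norm_vec_def[of "r \<otimes>\<^sub>t s"] row mult.commute)
  also have "\<dots> = norm s * norm r"
    by (simp add: L2_set_right_distrib[symmetric] norm_vec_def[of r])
  finally show ?thesis by simp
qed

lemma sum_rows_tensor: "(\<Sum>i\<in>UNIV. axis i 1 \<otimes>\<^sub>t (A $ i)) = A"
  by (simp add: vec_eq_iff tensor_def axis_def if_distrib if_distribR sum.delta cong: if_cong)

section \<open>Local minimizers over tensors of rank one\<close>

locale tensor_energy = strongly_convex_energy B E E' \<alpha>
  for B :: "real ^ 'm ^ 'l \<Rightarrow> real ^ 'm ^ 'l \<Rightarrow> real"
    and E :: "real ^ 'm ^ 'l \<Rightarrow> real" and E' :: "real ^ 'm ^ 'l \<Rightarrow> real ^ 'm ^ 'l"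
    and \<alpha> :: real
begin

lemma local_minimizer_along_curve:
  assumes "is_local_minimizer (\<lambda>(r', s'). E (w + r' \<otimes>\<^sub>t s')) (r, s)"
  shows "\<forall>\<^sub>F t in at 0. E (w + r \<otimes>\<^sub>t s) \<le> E (w + (r + t *\<^sub>R \<rho>) \<otimes>\<^sub>t (s + t *\<^sub>R \<eta>))"
proof -
  have "((\<lambda>t::real. (r + t *\<^sub>R \<rho>, s + t *\<^sub>R \<eta>)) \<longlongrightarrow> (r + 0 *\<^sub>R \<rho>, s + 0 *\<^sub>R \<eta>)) (at 0)"
    by (intro tendsto_intros)
  then have "filterlim (\<lambda>t::real. (r + t *\<^sub>R \<rho>, s + t *\<^sub>R \<eta>)) (nhds (r, s)) (at 0)" by simp
  from eventually_compose_filterlim[OF assms[unfolded is_local_minimizer_def] this]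
  show ?thesis by simp
qed

text \<open>
  The tensor \<open>r \<otimes>\<^sub>t s\<close> is itself a tangent direction, obtained by scaling \<open>r\<close>.
\<close>

lemma local_minimizer_orthogonal:
  assumes "is_local_minimizer (\<lambda>(r', s'). E (w + r' \<otimes>\<^sub>t s')) (r, s)"
  shows "B (E' (w + r \<otimes>\<^sub>t s)) (r \<otimes>\<^sub>t s) = 0"
proof -
  let ?x = "r \<otimes>\<^sub>t s" and ?v = "w + r \<otimes>\<^sub>t s"
  have "((\<lambda>t. E (?v + t *\<^sub>R ?x)) has_derivative (\<lambda>t. B (E' (?v + 0 *\<^sub>R ?x)) (t *\<^sub>R ?x))) (at (0::real))"
    by (rule has_derivative_compose[OF _ has_derivative]) (auto intro!: derivative_eq_intros)
  then have "((\<lambda>t. E (?v + t *\<^sub>R ?x)) has_real_derivative B (E' ?v) ?x) (at 0)"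
    by (simp add: has_field_derivative_def bilinear_rmul[OF bilinear] mult_commute_abs)
  moreover obtain d where "d > 0" and d: "\<And>t. t \<noteq> 0 \<Longrightarrow> dist t 0 < d \<Longrightarrow>
      E ?v \<le> E (w + (r + t *\<^sub>R r) \<otimes>\<^sub>t (s + t *\<^sub>R 0))"
    using local_minimizer_along_curve[OF assms, of r 0] unfolding eventually_at by auto
  have "\<forall>t. \<bar>0 - t\<bar> < d \<longrightarrow> E (?v + 0 *\<^sub>R ?x) \<le> E (?v + t *\<^sub>R ?x)"
  proof (intro allI impI)
    fix t :: real
    assume "\<bar>0 - t\<bar> < d"
    then show "E (?v + 0 *\<^sub>R ?x) \<le> E (?v + t *\<^sub>R ?x)"
      using d[of t] by (cases "t = 0") (simp_all add: tensor_simps add.assoc)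
  qed
  ultimately show ?thesis using \<open>d > 0\<close> DERIV_local_min by blast
qed

text \<open>
  Compare \<open>(r, s)\<close> with \<open>(r, s) + \<epsilon> (\<rho>, \<eta>)\<close> and with \<open>(r, s) - \<epsilon> (\<rho>, \<eta>)\<close>, and add the two
  inequalities: the contributions of order \<open>\<epsilon>\<close> cancel, those of order \<open>\<epsilon>\<^sup>2\<close> give the claim.
\<close>

lemma local_minimizer_second_order:
  assumes min: "is_local_minimizer (\<lambda>(r', s'). E (w + r' \<otimes>\<^sub>t s')) (r, s)"
    and v: "v = w + r \<otimes>\<^sub>t s"
    and upper: "\<And>h. norm h \<le> 1 \<Longrightarrow> E (v + h) \<le> E v + B (E' v) h + L * (norm_of B h)\<^sup>2"
  shows "- B (E' v) (\<rho> \<otimes>\<^sub>t \<eta>) \<le> L * (norm_of B (r \<otimes>\<^sub>t \<eta> + \<rho> \<otimes>\<^sub>t s))\<^sup>2"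
proof -
  let ?g = "E' v" and ?z = "\<rho> \<otimes>\<^sub>t \<eta>" and ?p = "r \<otimes>\<^sub>t \<eta> + \<rho> \<otimes>\<^sub>t s"
  let ?Q = "\<lambda>x. (norm_of B x)\<^sup>2"
  have increment: "\<forall>\<^sub>F \<epsilon> in at 0. 0 \<le> \<epsilon> * B ?g p + \<epsilon>\<^sup>2 * (B ?g ?z + L * ?Q (p + \<epsilon> *\<^sub>R ?z))"
    if p: "p = r \<otimes>\<^sub>t \<eta>' + \<rho>' \<otimes>\<^sub>t s" and z: "\<rho>' \<otimes>\<^sub>t \<eta>' = ?z" for p \<rho>' \<eta>'
  proof -
    have "((\<lambda>\<epsilon>::real. norm (\<epsilon> *\<^sub>R p + \<epsilon>\<^sup>2 *\<^sub>R ?z)) \<longlongrightarrow> norm (0 *\<^sub>R p + 0\<^sup>2 *\<^sub>R ?z)) (at 0)"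
      by (intro tendsto_intros)
    then have "\<forall>\<^sub>F \<epsilon> in at 0. norm (\<epsilon> *\<^sub>R p + \<epsilon>\<^sup>2 *\<^sub>R ?z) < 1"
      by (rule order_tendstoD) simp
    with local_minimizer_along_curve[OF min, of \<rho>' \<eta>'] show ?thesis
    proof eventually_elim
      case (elim \<epsilon>)
      let ?h = "\<epsilon> *\<^sub>R p + \<epsilon>\<^sup>2 *\<^sub>R ?z"
      have h: "w + (r + \<epsilon> *\<^sub>R \<rho>') \<otimes>\<^sub>t (s + \<epsilon> *\<^sub>R \<eta>') = v + ?h"
        by (simp add: v p tensor_simps flip: z)
           (simp add: power2_eq_square algebra_simps)
      have "?h = \<epsilon> *\<^sub>R (p + \<epsilon> *\<^sub>R ?z)" by (simp add: power2_eq_square algebra_simps)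
      then have "?Q ?h = \<epsilon>\<^sup>2 * ?Q (p + \<epsilon> *\<^sub>R ?z)"
        by (simp add: norm_of_scaleR[OF inner_product] power_mult_distrib)
      moreover have "E v \<le> E (v + ?h)" using elim(1) unfolding h by (simp add: v)
      moreover have "E (v + ?h) \<le> E v + B ?g ?h + L * ?Q ?h" using elim(2) by (intro upper) simp
      ultimately show ?case
        by (simp add: bilinear_radd[OF bilinear] bilinear_rmul[OF bilinear] algebra_simps)
    qed
  qed
  have "- ?p = r \<otimes>\<^sub>t (- \<eta>) + (- \<rho>) \<otimes>\<^sub>t s" "(- \<rho>) \<otimes>\<^sub>t (- \<eta>) = ?z"
    by (simp_all add: tensor_def vec_eq_iff)
  from increment[OF refl refl] increment[OF this] have "\<forall>\<^sub>F \<epsilon> in at 0.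
      - B ?g ?z \<le> L * (?Q ?p + \<epsilon>\<^sup>2 * ?Q ?z)"
    using eventually_neq_at_within[of 0 0 UNIV]
  proof eventually_elim
    case (elim \<epsilon>)
    have neg: "B x (- y) = - B x y" "B (- x) y = - B x y" for x y
      using bilinear_rneg[OF bilinear] bilinear_lneg[OF bilinear] by auto
    (* the two mixed terms 2 * \<epsilon> * B p z cancel: this is the parallelogram law *)
    have "0 \<le> 2 * \<epsilon>\<^sup>2 * (B ?g ?z + L * (?Q ?p + \<epsilon>\<^sup>2 * ?Q ?z))"
      using add_mono[OF elim(1,2)] 
      unfolding norm_of_square_add_scaleR[OF inner_product] norm_of_minus[OF inner_product] neg
      by (simp add: algebra_simps)
    then have "0 \<le> B ?g ?z + L * (?Q ?p + \<epsilon>\<^sup>2 * ?Q ?z)"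
      using elim(3) by (simp add: zero_le_mult_iff)
    then show ?case by simp
  qed
  moreover have "((\<lambda>\<epsilon>::real. L * (?Q ?p + \<epsilon>\<^sup>2 * ?Q ?z)) \<longlongrightarrow> L * (?Q ?p + 0\<^sup>2 * ?Q ?z)) (at 0)"
    by (intro tendsto_intros)
  ultimately have "- B ?g ?z \<le> L * (?Q ?p + 0\<^sup>2 * ?Q ?z)"
    by (intro tendsto_lowerbound) auto
  then show ?thesis by simp
qed

text \<open>
  The second-order condition is quadratic in the direction on the right but depends only on the
  tensor product on the left. Replacing \<open>(\<rho>, \<eta>)\<close> by \<open>(t \<rho>, \<eta> / t)\<close> with the \<open>t\<close> that
  makes the two summands of the tangent vector equally long gives a bound by the product of the
  norms.
\<close>

lemma local_minimizer_rank_one_bound: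
  assumes min: "is_local_minimizer (\<lambda>(r', s'). E (w + r' \<otimes>\<^sub>t s')) (r, s)"
    and v: "v = w + r \<otimes>\<^sub>t s"
    and upper: "\<And>h. norm h \<le> 1 \<Longrightarrow> E (v + h) \<le> E v + B (E' v) h + L * (norm_of B h)\<^sup>2"
    and "L > 0" and "r \<noteq> 0" and "s \<noteq> 0"
    and C: "C > 0" "\<And>x. norm_of B x \<le> C * norm x"
  shows "- B (E' v) (\<rho> \<otimes>\<^sub>t \<eta>) \<le> 4 * L * C\<^sup>2 * norm (r \<otimes>\<^sub>t s) * norm (\<rho> \<otimes>\<^sub>t \<eta>)"
proof (cases "\<rho> = 0 \<or> \<eta> = 0")
  case True
  then have "\<rho> \<otimes>\<^sub>t \<eta> = 0" by (auto simp: tensor_simps)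
  then show ?thesis by (simp add: bilinear_rzero[OF bilinear])
next
  case False
  define a b where "a = norm r * norm \<eta>" and "b = norm \<rho> * norm s"
  have "a > 0" "b > 0" using False \<open>r \<noteq> 0\<close> \<open>s \<noteq> 0\<close> by (auto simp: a_def b_def)
  define t where "t = sqrt (a / b)"
  have t: "t > 0" "t\<^sup>2 = a / b" using \<open>a > 0\<close> \<open>b > 0\<close> by (simp_all add: t_def)
  let ?p = "r \<otimes>\<^sub>t ((1 / t) *\<^sub>R \<eta>) + (t *\<^sub>R \<rho>) \<otimes>\<^sub>t s"
  have "norm ?p \<le> a / t + t * b"
    using norm_triangle_ineq[of "r \<otimes>\<^sub>t ((1 / t) *\<^sub>R \<eta>)" "(t *\<^sub>R \<rho>) \<otimes>\<^sub>t s"] t(1)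
    by (simp add: norm_tensor a_def b_def)
  also have "a / t = t * b"
    using t \<open>b > 0\<close> by (simp add: field_simps power2_eq_square)
  finally have "norm ?p \<le> 2 * t * b" by (simp add: mult_ac)
  then have "C * norm ?p \<le> C * (2 * t * b)" using C(1) by simp
  with C(2)[of ?p] have "norm_of B ?p \<le> C * (2 * t * b)" by linarith
  then have "(norm_of B ?p)\<^sup>2 \<le> (C * (2 * t * b))\<^sup>2"
    by (intro power_mono norm_of_nonneg[OF inner_product])
  also have "\<dots> = 4 * C\<^sup>2 * (t\<^sup>2 * b) * b" by (simp add: power2_eq_square)
  also have "t\<^sup>2 * b = a" using t(2) \<open>b > 0\<close> by simp
  finally have "L * (norm_of B ?p)\<^sup>2 \<le> L * (4 * C\<^sup>2 * a * b)" using \<open>L > 0\<close> by simp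
  moreover have "- B (E' v) ((t *\<^sub>R \<rho>) \<otimes>\<^sub>t ((1 / t) *\<^sub>R \<eta>)) \<le> L * (norm_of B ?p)\<^sup>2"
    by (rule local_minimizer_second_order[OF min v upper])
  moreover have "(t *\<^sub>R \<rho>) \<otimes>\<^sub>t ((1 / t) *\<^sub>R \<eta>) = \<rho> \<otimes>\<^sub>t \<eta>"
    using t(1) by (simp add: tensor_simps)
  ultimately have "- B (E' v) (\<rho> \<otimes>\<^sub>t \<eta>) \<le> L * (4 * C\<^sup>2 * a * b)" by simp
  then show ?thesis by (simp add: norm_tensor a_def b_def mult_ac)
qed

text \<open>
  Every tensor is the sum of its rows, each of rank one; testing the gradient against its own
  rows recovers its norm.
\<close>

lemma local_minimizer_gradient_bound:
  assumes min: "is_local_minimizer (\<lambda>(r', s'). E (w + r' \<otimes>\<^sub>t s')) (r, s)"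
    and v: "v = w + r \<otimes>\<^sub>t s"
    and upper: "\<And>h. norm h \<le> 1 \<Longrightarrow> E (v + h) \<le> E v + B (E' v) h + L * (norm_of B h)\<^sup>2"
    and "L > 0" and "r \<noteq> 0" and "s \<noteq> 0"
    and C: "C > 0" "\<And>x. norm_of B x \<le> C * norm x"
    and c: "c > 0" "\<And>x. c * norm x \<le> norm_of B x"
  shows "norm_of B (E' v) \<le> 4 * L * C\<^sup>2 * real CARD('l) / c\<^sup>2 * norm_of B (r \<otimes>\<^sub>t s)"
proof -
  let ?g = "E' v" and ?x = "r \<otimes>\<^sub>t s"
  define K where "K = 4 * L * C\<^sup>2"
  have "K \<ge> 0" using \<open>L > 0\<close> by (simp add: K_def)
  have row: "B ?g (axis i 1 \<otimes>\<^sub>t (?g $ i)) \<le> K * norm ?x * norm ?g" for i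
  proof -
    have "(- axis i 1) \<otimes>\<^sub>t (?g $ i) = - (axis i 1 \<otimes>\<^sub>t (?g $ i))"
      by (simp add: tensor_def vec_eq_iff)
    then have "B ?g (axis i 1 \<otimes>\<^sub>t (?g $ i)) = - B ?g ((- axis i 1) \<otimes>\<^sub>t (?g $ i))"
      by (simp add: bilinear_rneg[OF bilinear])
    also have "\<dots> \<le> K * norm ?x * norm ((- axis i 1) \<otimes>\<^sub>t (?g $ i))"
      unfolding K_def
      by (rule local_minimizer_rank_one_bound[OF min v upper \<open>L > 0\<close> \<open>r \<noteq> 0\<close> \<open>s \<noteq> 0\<close> C])
    also have "\<dots> = K * norm ?x * norm (?g $ i)" by (simp add: norm_tensor)
    also have "\<dots> \<le> K * norm ?x * norm ?g"
      using \<open>K \<ge> 0\<close> by (intro mult_left_mono Finite_Cartesian_Product.norm_nth_le) simp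
    finally show ?thesis .
  qed
  have lin: "linear (B ?g)" using bilinear by (simp add: bilinear_def)
  have "(norm_of B ?g)\<^sup>2 = B ?g (\<Sum>i\<in>UNIV. axis i 1 \<otimes>\<^sub>t (?g $ i))"
    by (simp add: norm_of_square[OF inner_product] sum_rows_tensor)
  also have "\<dots> = (\<Sum>i\<in>UNIV. B ?g (axis i 1 \<otimes>\<^sub>t (?g $ i)))"
    by (rule linear_sum[OF lin])
  also have "\<dots> \<le> (\<Sum>i\<in>(UNIV::'l set). K * norm ?x * norm ?g)"
    by (rule sum_mono) (rule row)
  also have "\<dots> = K * real CARD('l) * (norm ?x * norm ?g)" by simp
  also have "norm ?x * norm ?g \<le> (norm_of B ?x / c) * (norm_of B ?g / c)"
    using c(1) c(2)[of ?x] c(2)[of ?g]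
    by (intro mult_mono) (simp_all add: field_simps norm_of_nonneg[OF inner_product])
  then have "K * real CARD('l) * (norm ?x * norm ?g)
      \<le> K * real CARD('l) * ((norm_of B ?x / c) * (norm_of B ?g / c))"
    using \<open>K \<ge> 0\<close> by (intro mult_left_mono) simp_all
  finally have *: "norm_of B ?g * norm_of B ?g
      \<le> (K * real CARD('l) / c\<^sup>2 * norm_of B ?x) * norm_of B ?g"
    by (simp add: power2_eq_square)
  have "norm_of B ?g \<le> K * real CARD('l) / c\<^sup>2 * norm_of B ?x"
  proof (cases "norm_of B ?g = 0")
    case True
    then show ?thesis using \<open>K \<ge> 0\<close> by (simp add: norm_of_nonneg[OF inner_product])
  next
    case False
    then show ?thesis
      using norm_of_nonneg[OF inner_product, of ?g] by (intro mult_right_le_imp_le[OF *]) simp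
  qed
  then show ?thesis by (simp add: K_def)
qed

section \<open>Contraction of the energy excess\<close>

lemma local_greedy_sequence_step:
  assumes "local_greedy_sequence E u"
    and "u n \<noteq> global_minimizer E"
  obtains r s where "is_local_minimizer (\<lambda>(r', s'). E (u n + r' \<otimes>\<^sub>t s')) (r, s)"
    and "u (Suc n) = u n + r \<otimes>\<^sub>t s" and "E (u (Suc n)) < E (u n)"
proof -
  have "u n \<noteq> global_minimizer E \<Longrightarrow>
      \<exists>r s. is_local_minimizer (\<lambda>(r', s'). E (u n + r' \<otimes>\<^sub>t s')) (r, s) \<and>
            u (Suc n) = u n + r \<otimes>\<^sub>t s \<and> E (u (Suc n)) < E (u n)"
    using assms(1) unfolding local_greedy_sequence_def
    by (auto dest!: spec[of _ "Suc n"])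
  then show ?thesis using assms(2) that by blast
qed

lemma local_greedy_sequence_stop:
  assumes "local_greedy_sequence E u"
    and "u n = global_minimizer E"
  shows "u (Suc n) = global_minimizer E"
  using assms unfolding local_greedy_sequence_def by (auto dest!: spec[of _ "Suc n"])

lemma local_greedy_sequence_sublevel:
  assumes "local_greedy_sequence E u"
  shows "E (u n) \<le> E 0"
proof (induction n)
  case 0
  then show ?case using assms by (simp add: local_greedy_sequence_def)
next
  case (Suc n)
  show ?case
  proof (cases "u n = global_minimizer E")
    case True
    then show ?thesis
      using local_greedy_sequence_stop[OF assms] global_minimizer_le by simp
  next
    case False
    then obtain r s where "E (u (Suc n)) < E (u n)"
      using local_greedy_sequence_step[OF assms] by blast
    with Suc show ?thesis by simp
  qed
qed

text \<open>
  Let the step from \<open>u n\<close> to \<open>v = u (Suc n)\<close> add \<open>r \<otimes>\<^sub>t s\<close>. Its decrease is at least \<open>\<alpha> / 2 * \<parallel>r \<otimes>\<^sub>t s\<parallel>\<^sup>2\<close>, while the remaining excess is at most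
  \<open>\<parallel>E' v\<parallel>\<^sup>2 / (2 * \<alpha>)\<close>, hence \<open>G\<^sup>2 / (2 * \<alpha>) * \<parallel>r \<otimes>\<^sub>t s\<parallel>\<^sup>2\<close> if \<open>G\<close> is the constant of the gradient bound.
\<close>

lemma excess_le_decrease:
  assumes "lipschitz_on_bounded B E'"
  obtains D where "D > 0"
    and "\<And>u n. local_greedy_sequence E u \<Longrightarrow>
           E (u (Suc n)) - E (global_minimizer E) \<le> D * (E (u n) - E (u (Suc n)))"
proof -
  obtain C where C: "C > 0" "\<And>x. norm_of B x \<le> C * norm x"
    using norm_of_le_norm[OF inner_product] by blast
  obtain c where c: "c > 0" "\<And>x. c * norm x \<le> norm_of B x"
    using norm_le_norm_of[OF inner_product] by blast
  obtain L where L: "L > 0" "\<And>v h. E v \<le> E 0 \<Longrightarrow> norm h \<le> 1 \<Longrightarrow>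
      E (v + h) \<le> E v + B (E' v) h + L * (norm_of B h)\<^sup>2"
    using uniform_quadratic_upper_bound[OF assms] by blast
  define G where "G = 4 * L * C\<^sup>2 * real CARD('l) / c\<^sup>2"
  have "G > 0" using L(1) C(1) c(1) by (simp add: G_def)
  have "E (u (Suc n)) - E (global_minimizer E) \<le> (G / \<alpha>)\<^sup>2 * (E (u n) - E (u (Suc n)))"
    if u: "local_greedy_sequence E u" for u n
  proof (cases "u n = global_minimizer E")
    case True
    then show ?thesis using local_greedy_sequence_stop[OF u] by simp
  next
    case False
    then obtain r s where min: "is_local_minimizer (\<lambda>(r', s'). E (u n + r' \<otimes>\<^sub>t s')) (r, s)"
      and step: "u (Suc n) = u n + r \<otimes>\<^sub>t s" and less: "E (u (Suc n)) < E (u n)"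
      using local_greedy_sequence_step[OF u] by blast
    let ?v = "u (Suc n)" and ?x = "r \<otimes>\<^sub>t s"
    have nz: "r \<noteq> 0" "s \<noteq> 0" using step less by (auto simp: tensor_simps)
    have "norm_of B (E' ?v) \<le> G * norm_of B ?x"
      unfolding G_def
      using local_minimizer_gradient_bound[OF min step
          L(2)[OF local_greedy_sequence_sublevel[OF u]] L(1) nz C c] .
    then have "(norm_of B (E' ?v))\<^sup>2 \<le> (G * norm_of B ?x)\<^sup>2"
      by (intro power_mono norm_of_nonneg[OF inner_product])
    then have "(norm_of B (E' ?v))\<^sup>2 / (2 * \<alpha>) \<le> (G * norm_of B ?x)\<^sup>2 / (2 * \<alpha>)"
      using alpha_pos by (simp add: divide_right_mono)
    also have "\<dots> = (G / \<alpha>)\<^sup>2 * (\<alpha> / 2 * (norm_of B ?x)\<^sup>2)"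
      using alpha_pos by (simp add: power2_eq_square field_simps)
    also have "\<dots> \<le> (G / \<alpha>)\<^sup>2 * (E (u n) - E ?v)"
    proof (rule mult_left_mono)
      have diff: "u n - ?v = - ?x" by (simp add: step)
      have "B (E' ?v) (- ?x) = 0"
        using local_minimizer_orthogonal[OF min] by (simp add: step bilinear_rneg[OF bilinear])
      then show "\<alpha> / 2 * (norm_of B ?x)\<^sup>2 \<le> E (u n) - E ?v"
        using strong_convexity[of ?v "u n"] unfolding diff
        by (simp add: norm_of_minus[OF inner_product])
    qed simp
    finally show ?thesis using excess_le_gradient[of ?v "global_minimizer E"] by linarith
  qed
  moreover have "(G / \<alpha>)\<^sup>2 > 0" using \<open>G > 0\<close> alpha_pos by simp
  ultimately show ?thesis using that by blast
qed

end

theorem theorem5p2: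
  fixes B :: "real ^ 'm ^ 'l \<Rightarrow> real ^ 'm ^ 'l \<Rightarrow> real"
    and E :: "real ^ 'm ^ 'l \<Rightarrow> real"
    and E' :: "real ^ 'm ^ 'l \<Rightarrow> real ^ 'm ^ 'l"
    and \<alpha> :: real
    and u :: "nat \<Rightarrow> real ^ 'm ^ 'l"
  assumes "inner_product B"
    and "is_gradient B E E'"
    and A3: "strongly_convex B \<alpha> E E'"
    and A4: "lipschitz_on_bounded B E'"
    and "local_greedy_sequence E u"
  shows "\<exists>\<tau> \<sigma>. \<tau> > 0 \<and> 0 < \<sigma> \<and> \<sigma> < 1 \<and>
    (\<forall>n\<ge>1.
       0 \<le> E (u n) - E (global_minimizer E) \<and>
       E (u n) - E (global_minimizer E) \<le> \<tau> * \<sigma> ^ n \<and>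
       norm_of B (global_minimizer E - u n) \<le> sqrt (2 * \<tau> / \<alpha>) * \<sigma> powr (real n / 2))"
proof -
  interpret tensor_energy B E E' \<alpha>
    by unfold_locales (fact assms)+
  let ?w = "global_minimizer E"
  let ?a = "\<lambda>n. E (u n) - E ?w"
  obtain D where "D > 0" and D: "\<And>n. ?a (Suc n) \<le> D * (E (u n) - E (u (Suc n)))"
    using excess_le_decrease[OF A4] assms(5) by metis
  define \<sigma> where "\<sigma> = D / (1 + D)"
  (* the added 1 keeps \<tau> positive when the algorithm starts at the minimizer *)
  define \<tau> where "\<tau> = ?a 0 + 1"
  have \<sigma>: "0 < \<sigma>" "\<sigma> < 1" using \<open>D > 0\<close> by (simp_all add: \<sigma>_def)
  have nonneg: "0 \<le> ?a n" for n using global_minimizer_le[of "u n"] by simp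
  have "\<tau> > 0" using nonneg[of 0] by (simp add: \<tau>_def)
  have contraction: "?a (Suc n) \<le> \<sigma> * ?a n" for n
    using D[of n] \<open>D > 0\<close> by (simp add: \<sigma>_def field_simps)
  have decay: "?a n \<le> \<tau> * \<sigma> ^ n" for n
  proof (induction n)
    case 0
    show ?case by (simp add: \<tau>_def)
  next
    case (Suc n)
    from Suc have "\<sigma> * ?a n \<le> \<sigma> * (\<tau> * \<sigma> ^ n)" using \<sigma>(1) by simp
    with contraction[of n] show ?case by (simp add: mult_ac)
  qed
  have distance: "norm_of B (?w - u n) \<le> sqrt (2 * \<tau> / \<alpha>) * \<sigma> powr (real n / 2)" for n
  proof -
    have "\<alpha> / 2 * (norm_of B (?w - u n))\<^sup>2 \<le> \<tau> * \<sigma> ^ n"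
      using distance_le_excess[of "u n"] decay[of n] by linarith
    then have "(norm_of B (?w - u n))\<^sup>2 \<le> 2 * \<tau> / \<alpha> * \<sigma> ^ n"
      using alpha_pos by (simp add: field_simps)
    then have "norm_of B (?w - u n) \<le> sqrt (2 * \<tau> / \<alpha> * \<sigma> ^ n)"
      by (rule real_le_rsqrt)
    also have "\<dots> = sqrt (2 * \<tau> / \<alpha>) * sqrt (\<sigma> ^ n)" by (rule real_sqrt_mult)
    also have "sqrt (\<sigma> ^ n) = \<sigma> powr (real n / 2)"
      using \<sigma>(1) by (simp add: powr_half_sqrt[symmetric] powr_realpow[symmetric] powr_powr)
    finally show ?thesis .
  qed
  show ?thesis
    using \<open>\<tau> > 0\<close> \<sigma> nonneg decay distance by blast
qed

end
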